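(* Let $f,g:\mathcal K\to\mathbb R$ be filtration functions on the same finite CW complex $K$ with $\|f-g\|_\infty\le\varepsilon$, let $q\ge0$, let $M$ be a bottleneck matching of cost at most $\varepsilon$ between their $q$-th persistence diagrams, and let $\tau\ge0$. Assume $R_M^{(q)}(\tau)\ne\varnothing$. Equip $R_M^{(q)}(\tau)$ with a probability measure $\mu$ and its matched image $M(R_M^{(q)}(\tau))$ with the pushforward measure $M_\#\mu$. Using these measures and the same parameters $\alpha\in[0,1]$ and $s_q>0$ to compute the fused discrepancy between the two induced subgraphs, we have $$d_{\mathrm{FPG}}^{(q)}\Bigl(\mathcal G_f^{(q)}|_{R_M^{(q)}(\tau)},\ \mathcal G_g^{(q)}|_{M(R_M^{(q)}(\tau))}\Bigr)\le(1-\alpha)\min\Bigl\{\frac{\varepsilon}{s_q},1\Bigr\}+\alpha\,\Delta_{E,\mu}^{(q)}(M).$$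
   Context: Persistence pairing graphs. $\mathcal K$ is the set of cells of the finite CW complex $K$ (orientations fixed), $\Bbbk$ a field; a filtration function $f:\mathcal K\to\mathbb R$ satisfies $f(\tau)\le f(\sigma)$ whenever $\tau\subseteq\overline\sigma$. For each of $f$ and $g$ fix reduction data as follows (written for $f$). $\sigma_1\prec\dots\prec\sigma_N$ is a total order of the cells with $f(\sigma_i)<f(\sigma_j)\Rightarrow i<j$ and $\sigma_i\subseteq\overline{\sigma_j}$, $\sigma_i\neq\sigma_j\Rightarrow i<j$. $K_t$, $K_{t^-}$ are the subcomplexes of cells with $f\le t$, $f<t$, and $i_t:K_{t^-}\hookrightarrow K_t$. $D$ is the cellular boundary matrix and $R=DV$ with $V$ upper unitriangular and dimension preserving and $R$ reduced (distinct nonzero columns have distinct $\operatorname{low}$, where $\operatorname{low}(c)=\max\{i\mid c_i\ne0\}$). $\sigma_i$ is positive if $R_i=0$, with selected birth cycle $z_i=V_i$; $\operatorname{pair}(i)=j$ if $\operatorname{low}(R_j)=i$, and $\infty$ if there is no such $j$. The vertex set $V_f^{(q)}$ of $\mathcal G_f^{(q)}$ consists of the positive $q$-cells $u=\sigma_{i(u)}$ with $b_u<d_u$, where $b_u=f(\sigma_{i(u)})$, $d_u=f(\sigma_{\operatorname{pair}(i(u))})$ or $d_u=\infty$; $z_u=z_{i(u)}$; the vertex $u$ is decorated by the interval $[b_u,d_u)$. The intervals so indexed, with multiplicity, are exactly the $q$-th persistence diagram (barcode) of $f$. There is a directed edge $(u,v)\in E_f^{(q)}$ iff $d_u=t<\infty$,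 $b_v<t<d_v$ and $w_{uv}\ne0$, where $(i_t)_*[z_u]_{t^-}=\sum_{r:\,b_r<t<d_r}w_{ur}[z_r]_t$ in $H_q(K_t;\Bbbk)$ (a unique expansion). $A_f^{(q)}(u,u')=1$ if $(u,u')\in E_f^{(q)}$, else $0$; similarly for $g$. $\mathcal G|_S$ is the directed subgraph induced by the vertex set $S$. Matching. A bottleneck matching $M$ is a partial bijection between interval occurrences in $V_f^{(q)}$ and $V_g^{(q)}$, unmatched intervals being matched to the diagonal. The cost of matching finite intervals $u,v$ is $\max\{|b_u-b_v|,|d_u-d_v|\}$, of essential ($d=\infty$) intervals $|b_u-b_v|$, of a finite with an essential one $\infty$, of a finite interval with the diagonal $(d_u-b_u)/2$, and of an essential interval with the diagonal $\infty$; the cost of $M$ is the maximum of these. Let $\operatorname{pers}([b,d))=d-b$ ($=\infty$ if $d=\infty$), and $$R_M^{(q)}(\tau)=\{u\in V_f^{(q)}\mid M(u)\in V_g^{(q)},\ \operatorname{pers}(u)>\tau,\ \operatorname{pers}(M(u))>\tau\}.$$ For a probability measure $\mu$ on $R_M^{(q)}(\tau)$, $$\Delta_{E,\mu}^{(q)}(M)=\sum_{u,u'\in R_M^{(q)}(\tau)}\mu(u)\mu(u')\bigl|A_f^{(q)}(u,u')-A_g^{(q)}(M(u),M(u'))\bigr|.$$ Discrepancy. The vertex cost is $$\widetilde c_{\mathrm{node}}(u,v)=\begin{cases}\min\{\max\{|b_u-b_v|,|d_u-d_v|\}/s_q,\,1\}, & d_u,d_v<\infty,\\ \min\{|b_u-b_v|/s_q,\,1\},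 & d_u=d_v=\infty,\\ 1, & \text{exactly one of } d_u,d_v \text{ is infinite.}\end{cases}$$ For nonempty decorated directed graphs with vertex sets $V_1,V_2$, adjacency functions $A_1,A_2$ and probability measures $\mu_1,\mu_2$ on $V_1,V_2$, let $\Pi(\mu_1,\mu_2)$ be the set of nonnegative matrices $T=(T_{uv})$ with $\sum_vT_{uv}=\mu_1(u)$, $\sum_uT_{uv}=\mu_2(v)$, and $$d_{\mathrm{FPG}}^{(q)}=\min_{T\in\Pi(\mu_1,\mu_2)}\Bigl[(1-\alpha)\sum_{u,v}T_{uv}\,\widetilde c_{\mathrm{node}}(u,v)+\alpha\sum_{u,u'\in V_1}\sum_{v,v'\in V_2}T_{uv}T_{u'v'}|A_1(u,u')-A_2(v,v')|\Bigr].$$ *)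

theory Defs
  imports
    "HOL-Homology.Homology"
    "HOL-Probability.Probability"
    "Jordan_Normal_Form.Matrix"
    "Graph_Theory.Pair_Digraph"
begin

unbundle no vec_syntax
hide_const (open) Multiset.mult Polynomial.smult

section \<open>Finite CW complexes\<close>

text \<open>The closed disc, the open disc and the boundary sphere, in the coordinates used by
  \<^const>\<open>nsphere\<close>. In dimension 0 both discs are the origin and the boundary is empty.\<close>

definition closed_disc :: "nat \<Rightarrow> (nat \<Rightarrow> real) set" where
  "closed_disc n = {x \<in> topspace (Euclidean_space n). (\<Sum>i<n. (x i)\<^sup>2) \<le> 1}"

definition open_disc :: "nat \<Rightarrow> (nat \<Rightarrow> real) set" where
  "open_disc n = {x \<in> topspace (Euclidean_space n). (\<Sum>i<n. (x i)\<^sup>2) < 1}"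

definition disc_boundary :: "nat \<Rightarrow> (nat \<Rightarrow> real) set" where
  "disc_boundary n = {x \<in> topspace (Euclidean_space n). (\<Sum>i<n. (x i)\<^sup>2) = 1}"

text \<open>A cell is the open cell, as a subset of the space. The characteristic maps are part of the
  structure; they orient the cells.\<close>

record 'a cw_complex =
  cw_space :: "'a topology"
  cells :: "'a set set"
  cell_dim :: "'a set \<Rightarrow> nat"
  char_map :: "'a set \<Rightarrow> (nat \<Rightarrow> real) \<Rightarrow> 'a"

text \<open>With finitely many cells, closure-finiteness and the weak topology follow from the
  conditions below.\<close>

definition finite_cw_complex :: "'a cw_complex \<Rightarrow> bool" where
  "finite_cw_complex K \<longleftrightarrow>
     Hausdorff_space (cw_space K) \<and>
     finite (cells K) \<and>
     disjoint (cells K) \<and>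
     \<Union> (cells K) = topspace (cw_space K) \<and>
     (\<forall>\<sigma>\<in>cells K.
        continuous_map (subtopology (Euclidean_space (cell_dim K \<sigma>)) (closed_disc (cell_dim K \<sigma>)))
          (cw_space K) (char_map K \<sigma>) \<and>
        homeomorphic_map (subtopology (Euclidean_space (cell_dim K \<sigma>)) (open_disc (cell_dim K \<sigma>)))
          (subtopology (cw_space K) \<sigma>) (char_map K \<sigma>) \<and>
        char_map K \<sigma> ` disc_boundary (cell_dim K \<sigma>)
          \<subseteq> \<Union> {\<rho> \<in> cells K. cell_dim K \<rho> < cell_dim K \<sigma>})"

text \<open>\<open>wrap p\<close> induces a homeomorphism from the p-disc with its boundary collapsed to a point onto
  the p-sphere: the centre goes to the pole with last coordinate 1, the boundary to the opposite
  pole.\<close>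

definition wrap :: "nat \<Rightarrow> (nat \<Rightarrow> real) \<Rightarrow> (nat \<Rightarrow> real)" where
  "wrap p x = (let r = (\<Sum>i<p. (x i)\<^sup>2) in
     (\<lambda>i. if i < p then 2 * sqrt (1 - r) * x i else if i = p then 1 - 2 * r else 0))"

definition wrap_base :: "nat \<Rightarrow> (nat \<Rightarrow> real)" where
  "wrap_base p = (\<lambda>i. if i = p then - 1 else 0)"

text \<open>The attaching map of \<open>\<sigma>\<close>, followed by the collapse of everything in the skeleton outside
  the open cell \<open>\<tau>\<close>; here \<open>\<sigma>\<close> has dimension one more than \<open>\<tau>\<close>, and the result is a self-map of
  the sphere of dimension \<open>cell_dim K \<tau>\<close>.\<close>

definition collapsed_attaching_map ::
    "'a cw_complex \<Rightarrow> 'a set \<Rightarrow> 'a set \<Rightarrow> (nat \<Rightarrow> real) \<Rightarrow> (nat \<Rightarrow> real)" where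
  "collapsed_attaching_map K \<sigma> \<tau> y =
     (if char_map K \<sigma> y \<in> \<tau>
      then wrap (cell_dim K \<tau>)
             (inv_into (open_disc (cell_dim K \<tau>)) (char_map K \<tau>) (char_map K \<sigma> y))
      else wrap_base (cell_dim K \<tau>))"

text \<open>Incidence numbers of the cellular boundary operator. For a 1-cell this gives end point minus
  starting point. In higher dimensions the identification by \<^const>\<open>wrap\<close> may differ from another
  author's by a sign that depends on the dimension only.\<close>

definition incidence :: "'a cw_complex \<Rightarrow> 'a set \<Rightarrow> 'a set \<Rightarrow> int" where
  "incidence K \<sigma> \<tau> =
     (if cell_dim K \<sigma> = cell_dim K \<tau> + 1
      then Brouwer_degree2 (cell_dim K \<tau>) (collapsed_attaching_map K \<sigma> \<tau>)
      else 0)"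

section \<open>Filtrations and reduction data\<close>

definition filtration_function :: "'a cw_complex \<Rightarrow> ('a set \<Rightarrow> real) \<Rightarrow> bool" where
  "filtration_function K f \<longleftrightarrow>
     (\<forall>\<tau>\<in>cells K. \<forall>\<sigma>\<in>cells K. \<tau> \<subseteq> cw_space K closure_of \<sigma> \<longrightarrow> f \<tau> \<le> f \<sigma>)"

definition sublevel :: "'a cw_complex \<Rightarrow> ('a set \<Rightarrow> real) \<Rightarrow> real \<Rightarrow> 'a set set" where
  "sublevel K f t = {\<sigma> \<in> cells K. f \<sigma> \<le> t}"

definition strict_sublevel :: "'a cw_complex \<Rightarrow> ('a set \<Rightarrow> real) \<Rightarrow> real \<Rightarrow> 'a set set" where
  "strict_sublevel K f t = {\<sigma> \<in> cells K. f \<sigma> < t}"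

text \<open>The total order of the cells is an enumeration \<open>cs\<close>, with positions counted from 0.\<close>

definition compatible_order :: "'a cw_complex \<Rightarrow> ('a set \<Rightarrow> real) \<Rightarrow> 'a set list \<Rightarrow> bool" where
  "compatible_order K f cs \<longleftrightarrow>
     distinct cs \<and> set cs = cells K \<and>
     (\<forall>i<length cs. \<forall>j<length cs.
        (f (cs ! i) < f (cs ! j) \<longrightarrow> i < j) \<and>
        (cs ! i \<subseteq> cw_space K closure_of (cs ! j) \<and> cs ! i \<noteq> cs ! j \<longrightarrow> i < j))"

definition boundary_matrix :: "'a cw_complex \<Rightarrow> 'a set list \<Rightarrow> 'k::field mat" where
  "boundary_matrix K cs =
     mat (length cs) (length cs) (\<lambda>(i, j). of_int (incidence K (cs ! j) (cs ! i)))"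

definition low :: "'k::zero vec \<Rightarrow> nat" where
  "low c = Max {i. i < dim_vec c \<and> c $ i \<noteq> 0}"

definition reduced :: "'k::zero mat \<Rightarrow> bool" where
  "reduced R \<longleftrightarrow>
     (\<forall>j<dim_col R. \<forall>k<dim_col R.
        j \<noteq> k \<and> col R j \<noteq> 0\<^sub>v (dim_row R) \<and> col R k \<noteq> 0\<^sub>v (dim_row R)
        \<longrightarrow> low (col R j) \<noteq> low (col R k))"

definition reduction_data ::
    "'a cw_complex \<Rightarrow> ('a set \<Rightarrow> real) \<Rightarrow> 'a set list \<Rightarrow> 'k::field mat \<Rightarrow> bool" where
  "reduction_data K f cs V \<longleftrightarrow>
     compatible_order K f cs \<and>
     V \<in> carrier_mat (length cs) (length cs) \<and>
     upper_triangular V \<and>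
     (\<forall>i<length cs. V $$ (i, i) = 1) \<and>
     (\<forall>i<length cs. \<forall>j<length cs. V $$ (i, j) \<noteq> 0 \<longrightarrow> cell_dim K (cs ! i) = cell_dim K (cs ! j)) \<and>
     reduced (boundary_matrix K cs * V)"

definition positive :: "'a cw_complex \<Rightarrow> 'a set list \<Rightarrow> 'k::field mat \<Rightarrow> nat \<Rightarrow> bool" where
  "positive K cs V i \<longleftrightarrow> col (boundary_matrix K cs * V) i = 0\<^sub>v (length cs)"

definition is_pair :: "'a cw_complex \<Rightarrow> 'a set list \<Rightarrow> 'k::field mat \<Rightarrow> nat \<Rightarrow> nat \<Rightarrow> bool" where
  "is_pair K cs V i j \<longleftrightarrow>
     j < length cs \<and> col (boundary_matrix K cs * V) j \<noteq> 0\<^sub>v (length cs) \<and>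
     low (col (boundary_matrix K cs * V) j) = i"

text \<open>\<^const>\<open>None\<close> stands for an infinite pairing index.\<close>

definition pair_index :: "'a cw_complex \<Rightarrow> 'a set list \<Rightarrow> 'k::field mat \<Rightarrow> nat \<Rightarrow> nat option" where
  "pair_index K cs V i =
     (if \<exists>j. is_pair K cs V i j then Some (THE j. is_pair K cs V i j) else None)"

definition position :: "'a set list \<Rightarrow> 'a set \<Rightarrow> nat" where
  "position cs u = (THE i. i < length cs \<and> cs ! i = u)"

definition death_value ::
    "'a cw_complex \<Rightarrow> ('a set \<Rightarrow> real) \<Rightarrow> 'a set list \<Rightarrow> 'k::field mat \<Rightarrow> 'a set \<Rightarrow> ereal" where
  "death_value K f cs V u =
     (case pair_index K cs V (position cs u) of None \<Rightarrow> \<infinity> | Some j \<Rightarrow> ereal (f (cs ! j)))"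

definition birth_cycle :: "'a set list \<Rightarrow> 'k::field mat \<Rightarrow> 'a set \<Rightarrow> 'k vec" where
  "birth_cycle cs V u = col V (position cs u)"

section \<open>Cellular homology of a set of cells\<close>

text \<open>Chains are coefficient vectors with respect to \<open>cs\<close>, supported on the \<open>q\<close>-cells in \<open>L\<close>.\<close>

definition chains :: "'a cw_complex \<Rightarrow> 'a set list \<Rightarrow> nat \<Rightarrow> 'a set set \<Rightarrow> 'k::field vec set" where
  "chains K cs q L =
     {c \<in> carrier_vec (length cs). \<forall>i<length cs. c $ i \<noteq> 0 \<longrightarrow> cs ! i \<in> L \<and> cell_dim K (cs ! i) = q}"

definition cycles :: "'a cw_complex \<Rightarrow> 'a set list \<Rightarrow> nat \<Rightarrow> 'a set set \<Rightarrow> 'k::field vec set" where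
  "cycles K cs q L =
     {c \<in> chains K cs q L. boundary_matrix K cs *\<^sub>v c = 0\<^sub>v (length cs)}"

definition boundaries :: "'a cw_complex \<Rightarrow> 'a set list \<Rightarrow> nat \<Rightarrow> 'a set set \<Rightarrow> 'k::field vec set" where
  "boundaries K cs q L = (\<lambda>c. boundary_matrix K cs *\<^sub>v c) ` chains K cs (Suc q) L"

definition cycle_space ::
    "'a cw_complex \<Rightarrow> 'a set list \<Rightarrow> nat \<Rightarrow> 'a set set \<Rightarrow> ('k::field, 'k vec) module" where
  "cycle_space K cs q L = (module_vec TYPE('k) (length cs))\<lparr>carrier := cycles K cs q L\<rparr>"

definition homology_class ::
    "'a cw_complex \<Rightarrow> 'a set list \<Rightarrow> nat \<Rightarrow> 'a set set \<Rightarrow> 'k::field vec \<Rightarrow> 'k vec set" where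
  "homology_class K cs q L z = boundaries K cs q L +>\<^bsub>cycle_space K cs q L\<^esub> z"

text \<open>The quotient of cycles by boundaries as a vector space; \<open>mult\<close> and \<open>one\<close> carry no meaning,
  as in \<^const>\<open>module_vec\<close>. In the scalar action the boundaries are added because multiplying a
  coset elementwise by 0 does not give a coset.\<close>

definition cellular_homology ::
    "'a cw_complex \<Rightarrow> 'a set list \<Rightarrow> nat \<Rightarrow> 'a set set \<Rightarrow> ('k::field, 'k vec set) module" where
  "cellular_homology K cs q L =
     \<lparr> carrier = a_rcosets\<^bsub>cycle_space K cs q L\<^esub> (boundaries K cs q L),
       mult = undefined, one = undefined,
       zero = boundaries K cs q L,
       add = (\<lambda>A B. A <+>\<^bsub>cycle_space K cs q L\<^esub> B),
       smult = (\<lambda>a A. boundaries K cs q L <+>\<^bsub>cycle_space K cs q L\<^esub> ((\<lambda>x. a \<cdot>\<^sub>v x) ` A)) \<rparr>"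

text \<open>The map induced by an inclusion into \<open>L\<close>: a coset of the smaller boundary space is sent to the
  coset of the boundary space of \<open>L\<close> containing it.\<close>

definition inclusion_induced ::
    "'a cw_complex \<Rightarrow> 'a set list \<Rightarrow> nat \<Rightarrow> 'a set set \<Rightarrow> 'k::field vec set \<Rightarrow> 'k vec set" where
  "inclusion_induced K cs q L A = boundaries K cs q L <+>\<^bsub>cycle_space K cs q L\<^esub> A"

section \<open>Persistence pairing graphs\<close>

record 'v decorated_digraph = "'v pair_pre_digraph" +
  birth :: "'v \<Rightarrow> real"
  death :: "'v \<Rightarrow> ereal"

definition induced :: "'v decorated_digraph \<Rightarrow> 'v set \<Rightarrow> 'v decorated_digraph" where
  "induced G S = G\<lparr>pverts := S, parcs := {(u, v) \<in> parcs G. u \<in> S \<and> v \<in> S}\<rparr>"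

definition adjacency :: "'v decorated_digraph \<Rightarrow> 'v \<Rightarrow> 'v \<Rightarrow> real" where
  "adjacency G u v = (if (u, v) \<in> parcs G then 1 else 0)"

definition pairing_vertices ::
    "'a cw_complex \<Rightarrow> ('a set \<Rightarrow> real) \<Rightarrow> 'a set list \<Rightarrow> 'k::field mat \<Rightarrow> nat \<Rightarrow> 'a set set" where
  "pairing_vertices K f cs V q =
     {u \<in> cells K. cell_dim K u = q \<and> positive K cs V (position cs u) \<and>
        ereal (f u) < death_value K f cs V u}"

definition alive_across ::
    "'a cw_complex \<Rightarrow> ('a set \<Rightarrow> real) \<Rightarrow> 'a set list \<Rightarrow> 'k::field mat \<Rightarrow> nat \<Rightarrow> real \<Rightarrow> 'a set set" where
  "alive_across K f cs V q t =
     {r \<in> pairing_vertices K f cs V q. f r < t \<and> ereal t < death_value K f cs V r}"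

definition is_transition_expansion ::
    "'a cw_complex \<Rightarrow> ('a set \<Rightarrow> real) \<Rightarrow> 'a set list \<Rightarrow> 'k::field mat \<Rightarrow> nat \<Rightarrow> real \<Rightarrow> 'a set
      \<Rightarrow> ('a set \<Rightarrow> 'k) \<Rightarrow> bool" where
  "is_transition_expansion K f cs V q t u w \<longleftrightarrow>
     (\<forall>r. r \<notin> alive_across K f cs V q t \<longrightarrow> w r = 0) \<and>
     inclusion_induced K cs q (sublevel K f t)
         (homology_class K cs q (strict_sublevel K f t) (birth_cycle cs V u)) =
       (\<Oplus>\<^bsub>cellular_homology K cs q (sublevel K f t)\<^esub>r\<in>alive_across K f cs V q t.
          w r \<odot>\<^bsub>cellular_homology K cs q (sublevel K f t)\<^esub>
            homology_class K cs q (sublevel K f t) (birth_cycle cs V r))"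

text \<open>The expansion of the class of \<open>u\<close> at \<open>t\<close> exists and is unique when \<open>t\<close> is the finite death
  value of the vertex \<open>u\<close>, the only case in which the weight is used.\<close>

definition transition_weight ::
    "'a cw_complex \<Rightarrow> ('a set \<Rightarrow> real) \<Rightarrow> 'a set list \<Rightarrow> 'k::field mat \<Rightarrow> nat \<Rightarrow> real \<Rightarrow> 'a set
      \<Rightarrow> 'a set \<Rightarrow> 'k" where
  "transition_weight K f cs V q t u = (THE w. is_transition_expansion K f cs V q t u w)"

definition pairing_edges ::
    "'a cw_complex \<Rightarrow> ('a set \<Rightarrow> real) \<Rightarrow> 'a set list \<Rightarrow> 'k::field mat \<Rightarrow> nat \<Rightarrow> ('a set \<times> 'a set) set" where
  "pairing_edges K f cs V q =
     {(u, v). u \<in> pairing_vertices K f cs V q \<and> v \<in> pairing_vertices K f cs V q \<and>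
        (\<exists>t::real. death_value K f cs V u = ereal t \<and> f v < t \<and> ereal t < death_value K f cs V v \<and>
           transition_weight K f cs V q t u v \<noteq> 0)}"

definition pairing_graph ::
    "'a cw_complex \<Rightarrow> ('a set \<Rightarrow> real) \<Rightarrow> 'a set list \<Rightarrow> 'k::field mat \<Rightarrow> nat
      \<Rightarrow> 'a set decorated_digraph" where
  "pairing_graph K f cs V q =
     \<lparr> pverts = pairing_vertices K f cs V q, parcs = pairing_edges K f cs V q,
       birth = f, death = death_value K f cs V \<rparr>"

section \<open>Bottleneck matchings\<close>

definition pers :: "'v decorated_digraph \<Rightarrow> 'v \<Rightarrow> ereal" where
  "pers G u = death G u - ereal (birth G u)"

definition pair_cost :: "'v decorated_digraph \<Rightarrow> 'w decorated_digraph \<Rightarrow> 'v \<Rightarrow> 'w \<Rightarrow> ereal" where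
  "pair_cost G H u v =
     (if death G u < \<infinity> \<and> death H v < \<infinity>
      then max (ereal \<bar>birth G u - birth H v\<bar>) \<bar>death G u - death H v\<bar>
      else if death G u = \<infinity> \<and> death H v = \<infinity> then ereal \<bar>birth G u - birth H v\<bar>
      else \<infinity>)"

definition diagonal_cost :: "'v decorated_digraph \<Rightarrow> 'v \<Rightarrow> ereal" where
  "diagonal_cost G u = (if death G u < \<infinity> then (death G u - ereal (birth G u)) / 2 else \<infinity>)"

definition bottleneck_matching ::
    "'v decorated_digraph \<Rightarrow> 'w decorated_digraph \<Rightarrow> ('v \<rightharpoonup> 'w) \<Rightarrow> bool" where
  "bottleneck_matching G H M \<longleftrightarrow> dom M \<subseteq> pverts G \<and> ran M \<subseteq> pverts H \<and> inj_on M (dom M)"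

text \<open>The element 0 only matters when both diagrams are empty.\<close>

definition matching_cost ::
    "'v decorated_digraph \<Rightarrow> 'w decorated_digraph \<Rightarrow> ('v \<rightharpoonup> 'w) \<Rightarrow> ereal" where
  "matching_cost G H M =
     Max ({0} \<union> {pair_cost G H u v | u v. M u = Some v}
           \<union> diagonal_cost G ` (pverts G - dom M) \<union> diagonal_cost H ` (pverts H - ran M))"

definition robust_matched ::
    "'v decorated_digraph \<Rightarrow> 'w decorated_digraph \<Rightarrow> ('v \<rightharpoonup> 'w) \<Rightarrow> real \<Rightarrow> 'v set" where
  "robust_matched G H M \<tau> =
     {u \<in> pverts G. \<exists>v\<in>pverts H. M u = Some v \<and> pers G u > ereal \<tau> \<and> pers H v > ereal \<tau>}"

definition edge_discrepancy ::
    "'v decorated_digraph \<Rightarrow> 'w decorated_digraph \<Rightarrow> ('v \<rightharpoonup> 'w) \<Rightarrow> real \<Rightarrow> 'v pmf \<Rightarrow> real" where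
  "edge_discrepancy G H M \<tau> \<mu> =
     (\<Sum>u\<in>robust_matched G H M \<tau>. \<Sum>u'\<in>robust_matched G H M \<tau>.
        pmf \<mu> u * pmf \<mu> u' * \<bar>adjacency G u u' - adjacency H (the (M u)) (the (M u'))\<bar>)"

section \<open>The fused discrepancy\<close>

definition node_cost ::
    "real \<Rightarrow> 'v decorated_digraph \<Rightarrow> 'w decorated_digraph \<Rightarrow> 'v \<Rightarrow> 'w \<Rightarrow> real" where
  "node_cost s G H u v =
     (if death G u < \<infinity> \<and> death H v < \<infinity>
      then min (max \<bar>birth G u - birth H v\<bar>
                    \<bar>real_of_ereal (death G u) - real_of_ereal (death H v)\<bar> / s) 1
      else if death G u = \<infinity> \<and> death H v = \<infinity> then min (\<bar>birth G u - birth H v\<bar> / s) 1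
      else 1)"

text \<open>Transport matrices are normalised to vanish outside the two vertex sets.\<close>

definition couplings :: "'v set \<Rightarrow> 'w set \<Rightarrow> 'v pmf \<Rightarrow> 'w pmf \<Rightarrow> ('v \<Rightarrow> 'w \<Rightarrow> real) set" where
  "couplings V1 V2 \<mu>1 \<mu>2 =
     {T. (\<forall>u v. 0 \<le> T u v) \<and> (\<forall>u v. u \<notin> V1 \<or> v \<notin> V2 \<longrightarrow> T u v = 0) \<and>
         (\<forall>u\<in>V1. (\<Sum>v\<in>V2. T u v) = pmf \<mu>1 u) \<and> (\<forall>v\<in>V2. (\<Sum>u\<in>V1. T u v) = pmf \<mu>2 v)}"

definition fused_objective ::
    "real \<Rightarrow> real \<Rightarrow> 'v decorated_digraph \<Rightarrow> 'w decorated_digraph \<Rightarrow> ('v \<Rightarrow> 'w \<Rightarrow> real) \<Rightarrow> real" where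
  "fused_objective \<alpha> s G H T =
     (1 - \<alpha>) * (\<Sum>u\<in>pverts G. \<Sum>v\<in>pverts H. T u v * node_cost s G H u v) +
     \<alpha> * (\<Sum>u\<in>pverts G. \<Sum>u'\<in>pverts G. \<Sum>v\<in>pverts H. \<Sum>v'\<in>pverts H.
            T u v * T u' v' * \<bar>adjacency G u u' - adjacency H v v'\<bar>)"

definition d_FPG ::
    "real \<Rightarrow> real \<Rightarrow> 'v decorated_digraph \<Rightarrow> 'w decorated_digraph \<Rightarrow> 'v pmf \<Rightarrow> 'w pmf \<Rightarrow> real" where
  "d_FPG \<alpha> s G H \<mu>1 \<mu>2 =
     (INF T\<in>couplings (pverts G) (pverts H) \<mu>1 \<mu>2. fused_objective \<alpha> s G H T)"

text \<open>The infimum is a minimum.\<close>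

lemma compact_fun_box: "compact {T :: 'v \<Rightarrow> 'w \<Rightarrow> real. \<forall>u v. T u v \<in> {0..1}}"
proof -
  have 1: "compact (PiE UNIV (\<lambda>_::'w. {0..1::real}))"
    using compactin_PiE[of "\<lambda>_::'w. euclidean :: real topology" UNIV "\<lambda>_. {0..1}"]
    by (simp add: euclidean_product_topology)
  have "compact (PiE UNIV (\<lambda>_::'v. PiE UNIV (\<lambda>_::'w. {0..1::real})))"
    using compactin_PiE[of "\<lambda>_::'v. euclidean :: ('w \<Rightarrow> real) topology" UNIV "\<lambda>_. PiE UNIV (\<lambda>_::'w. {0..1::real})"] 1
    by (simp add: euclidean_product_topology)
  moreover have "PiE UNIV (\<lambda>_::'v. PiE UNIV (\<lambda>_::'w. {0..1::real})) = {T. \<forall>u v. T u v \<in> {0..1}}"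
    by (auto simp: PiE_UNIV_domain Pi_iff)
  ultimately show ?thesis by simp
qed

lemma continuous_on_entry:
  fixes S :: "('v \<Rightarrow> 'w \<Rightarrow> real) set"
  shows "continuous_on S (\<lambda>T. T u v)"
  by (rule continuous_on_product_then_coordinatewise[OF
        continuous_on_product_then_coordinatewise[OF continuous_on_id]])

lemma d_FPG_attained:
  fixes G :: "'v decorated_digraph" and H :: "'w decorated_digraph"
  assumes fin: "finite (pverts G)" "finite (pverts H)"
    and supp: "set_pmf \<mu>1 \<subseteq> pverts G" "set_pmf \<mu>2 \<subseteq> pverts H"
  shows "\<exists>T\<in>couplings (pverts G) (pverts H) \<mu>1 \<mu>2.
           fused_objective \<alpha> s G H T = d_FPG \<alpha> s G H \<mu>1 \<mu>2 \<and>
           (\<forall>T'\<in>couplings (pverts G) (pverts H) \<mu>1 \<mu>2.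
              fused_objective \<alpha> s G H T \<le> fused_objective \<alpha> s G H T')"
proof -
  let ?C = "couplings (pverts G) (pverts H) \<mu>1 \<mu>2"
  let ?B = "{T :: 'v \<Rightarrow> 'w \<Rightarrow> real. \<forall>u v. T u v \<in> {0..1}}"
  let ?E = "{T :: 'v \<Rightarrow> 'w \<Rightarrow> real. (\<forall>u v. u \<notin> pverts G \<or> v \<notin> pverts H \<longrightarrow> T u v = 0) \<and>
         (\<forall>u\<in>pverts G. (\<Sum>v\<in>pverts H. T u v) = pmf \<mu>1 u) \<and>
         (\<forall>v\<in>pverts H. (\<Sum>u\<in>pverts G. T u v) = pmf \<mu>2 v)}"
  have le1: "T u v \<le> 1" if T: "T \<in> ?C" for T u v
  proof (cases "u \<in> pverts G \<and> v \<in> pverts H")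
    case True
    have "T u v \<le> (\<Sum>v\<in>pverts H. T u v)"
      using T True fin by (intro member_le_sum) (auto simp: couplings_def)
    also have "\<dots> = pmf \<mu>1 u" using T True by (auto simp: couplings_def)
    also have "\<dots> \<le> 1" by (rule pmf_le_1)
    finally show ?thesis .
  next
    case False
    then show ?thesis using T by (auto simp: couplings_def)
  qed
  have C: "?C = ?B \<inter> ?E"
    using le1 by (auto simp: couplings_def)
  have E: "?E = (\<Inter>u. \<Inter>v. {T. u \<notin> pverts G \<or> v \<notin> pverts H \<longrightarrow> T u v = 0}) \<inter>
        (\<Inter>u\<in>pverts G. {T. (\<Sum>v\<in>pverts H. T u v) = pmf \<mu>1 u}) \<inter>
        (\<Inter>v\<in>pverts H. {T. (\<Sum>u\<in>pverts G. T u v) = pmf \<mu>2 v})"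
    by blast
  have "closed ?E"
    unfolding E
    by (intro closed_Int closed_INT ballI closed_Collect_imp open_Collect_const closed_Collect_eq
          continuous_on_sum continuous_on_entry continuous_on_const)
  then have "compact ?C"
    unfolding C using compact_fun_box by (rule compact_Int_closed[rotated])
  moreover have "(\<lambda>u v. pmf \<mu>1 u * pmf \<mu>2 v) \<in> ?C"
    using fin supp
    using pmf_eq_0_set_pmf[of \<mu>1] pmf_eq_0_set_pmf[of \<mu>2]
    by (auto simp: couplings_def sum_pmf_eq_1 simp flip: sum_distrib_left sum_distrib_right)
  moreover have "continuous_on ?C (fused_objective \<alpha> s G H)"
    unfolding fused_objective_def
    by (intro continuous_on_add continuous_on_mult continuous_on_sum continuous_on_entry continuous_on_const)
  ultimately obtain T where T: "T \<in> ?C"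
    and min: "\<forall>T'\<in>?C. fused_objective \<alpha> s G H T \<le> fused_objective \<alpha> s G H T'"
    using continuous_attains_inf[of ?C "fused_objective \<alpha> s G H"] by blast
  have "fused_objective \<alpha> s G H T = d_FPG \<alpha> s G H \<mu>1 \<mu>2"
    unfolding d_FPG_def using T min
    by (intro antisym cINF_greatest cINF_lower bdd_belowI2) auto
  then show ?thesis using T min by blast
qed

end

theory Submission
  imports Defs
begin

text \<open>The coupling carried by the graph of the matching transports \<open>\<mu>\<close> to its pushforward. Its edge
  term is exactly the edge discrepancy, and its node term is a \<open>\<mu>\<close>-average of costs of matched
  pairs, each at most the cost of the matching.\<close>

text \<open>For a point of \<open>R\<close> of mass zero, injectivity on all of \<open>R\<close>
  keeps \<open>m x\<close> outside the image of the support, so both masses vanish.\<close>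

lemma pmf_map_inj_on:
  assumes "inj_on m R" "set_pmf \<mu> \<subseteq> R" "x \<in> R"
  shows "pmf (map_pmf m \<mu>) (m x) = pmf \<mu> x"
proof (cases "x \<in> set_pmf \<mu>")
  case True
  then show ?thesis
    using assms by (intro pmf_map_inj) (auto intro: inj_on_subset)
next
  case False
  then have "m x \<notin> set_pmf (map_pmf m \<mu>)"
    using assms by (auto simp: inj_on_def)
  with False show ?thesis by (metis pmf_eq_0_set_pmf)
qed

definition graph_coupling :: "('v \<Rightarrow> 'w) \<Rightarrow> 'v set \<Rightarrow> 'v pmf \<Rightarrow> 'v \<Rightarrow> 'w \<Rightarrow> real" where
  "graph_coupling m R \<mu> u v = (if u \<in> R \<and> v = m u then pmf \<mu> u else 0)"

text \<open>Row \<open>u\<close> is concentrated at \<open>m u\<close>. The weight \<open>h\<close>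
  lets one rule serve the row marginals, with \<open>h\<close> constantly 1, and both sums of the
  objective.\<close>

lemma sum_graph_coupling:
  assumes "finite R" "u \<in> R"
  shows "(\<Sum>v\<in>m ` R. graph_coupling m R \<mu> u v * h v) = pmf \<mu> u * h (m u)"
proof -
  have "(\<Sum>v\<in>m ` R. graph_coupling m R \<mu> u v * h v) =
        (\<Sum>v\<in>m ` R. if v = m u then pmf \<mu> u * h v else 0)"
    using assms by (intro sum.cong) (auto simp: graph_coupling_def)
  also have "\<dots> = pmf \<mu> u * h (m u)"
    using assms by (simp add: sum.delta)
  finally show ?thesis .
qed

lemma graph_coupling_in_couplings:
  assumes fin: "finite R" and inj: "inj_on m R" and supp: "set_pmf \<mu> \<subseteq> R"
  shows "graph_coupling m R \<mu> \<in> couplings R (m ` R) \<mu> (map_pmf m \<mu>)"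
proof -
  \<comment> \<open>Column marginals: by injectivity of \<open>m\<close>, only row \<open>x\<close>
    contributes to column \<open>m x\<close>.\<close>
  have "(\<Sum>u\<in>R. graph_coupling m R \<mu> u (m x)) = pmf (map_pmf m \<mu>) (m x)" if "x \<in> R" for x
  proof -
    have "(\<Sum>u\<in>R. graph_coupling m R \<mu> u (m x)) = (\<Sum>u\<in>R. if u = x then pmf \<mu> u else 0)"
      using inj that by (intro sum.cong) (auto simp: graph_coupling_def inj_on_def)
    then show ?thesis
      using fin that pmf_map_inj_on[OF inj supp that] by (simp add: sum.delta)
  qed
  moreover have "(\<Sum>v\<in>m ` R. graph_coupling m R \<mu> u v) = pmf \<mu> u" if "u \<in> R" for u
    using sum_graph_coupling[OF fin that, of m \<mu> "\<lambda>_. 1"] by simp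
  ultimately show ?thesis
    unfolding couplings_def by (auto simp: graph_coupling_def)
qed

lemma fused_objective_graph_coupling:
  assumes "finite (pverts G)" "pverts H = m ` pverts G"
  shows "fused_objective \<alpha> s G H (graph_coupling m (pverts G) \<mu>) =
    (1 - \<alpha>) * (\<Sum>u\<in>pverts G. pmf \<mu> u * node_cost s G H u (m u)) +
    \<alpha> * (\<Sum>u\<in>pverts G. \<Sum>u'\<in>pverts G.
           pmf \<mu> u * pmf \<mu> u' * \<bar>adjacency G u u' - adjacency H (m u) (m u')\<bar>)"
  unfolding fused_objective_def assms(2)
  using assms(1)
  \<comment> \<open>The factor for \<open>(u, v)\<close> is pulled out of the sum over
    \<open>v'\<close>; that sum collapses to \<open>v' = m u'\<close>, and then the sum over
    \<open>v\<close> to \<open>v = m u\<close>.\<close>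
  by (simp add: sum_graph_coupling mult.assoc flip: sum_distrib_left cong: sum.cong)

text \<open>If just one death value is \<infinity>, or some death value is -\<infinity>, then
  \<open>pair_cost\<close> is \<infinity>, contrary to the real bound. Otherwise
  \<open>node_cost\<close> is \<open>pair_cost\<close> divided by \<open>s\<close> and truncated at
  1.\<close>

lemma node_cost_le:
  assumes "pair_cost G H u v \<le> ereal \<epsilon>" "0 < s"
  shows "node_cost s G H u v \<le> min (\<epsilon> / s) 1"
  using assms
  by (cases "death G u"; cases "death H v")
     (auto simp: pair_cost_def node_cost_def min_le_iff_disj divide_right_mono)

lemma pair_cost_le_matching_cost:
  assumes "finite (pverts G)" "finite (pverts H)" "bottleneck_matching G H M" "M u = Some v"
  shows "pair_cost G H u v \<le> matching_cost G H M"
proof -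
  \<comment> \<open>As an image of \<open>dom M\<close> the set of pair costs is finite, which
    \<open>Max_ge\<close> requires.\<close>
  have "{pair_cost G H u v | u v. M u = Some v} = (\<lambda>u. pair_cost G H u (the (M u))) ` dom M"
    by force
  moreover have "finite (dom M)"
    using assms by (auto simp: bottleneck_matching_def intro: finite_subset)
  ultimately show ?thesis
    unfolding matching_cost_def using assms by (intro Max_ge) auto
qed

lemma d_FPG_robust_matched_le:
  fixes G :: "'v decorated_digraph" and H :: "'w decorated_digraph" and M :: "'v \<rightharpoonup> 'w"
  defines "m \<equiv> the \<circ> M"
  assumes fin: "finite (pverts G)" "finite (pverts H)"
    and M: "bottleneck_matching G H M" "matching_cost G H M \<le> ereal \<epsilon>"
    and R: "R = robust_matched G H M \<tau>"
    and supp: "set_pmf \<mu> \<subseteq> R"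
    and "\<alpha> \<le> 1" "0 < s"
  shows "d_FPG \<alpha> s (induced G R) (induced H (m ` R)) \<mu> (map_pmf m \<mu>)
           \<le> (1 - \<alpha>) * min (\<epsilon> / s) 1 + \<alpha> * edge_discrepancy G H M \<tau> \<mu>"
proof -
  let ?G = "induced G R" and ?H = "induced H (m ` R)"
  have verts: "pverts ?G = R" "pverts ?H = m ` R"
    by (simp_all add: induced_def)
  \<comment> \<open>On \<open>R\<close> the map \<open>M\<close> is defined, so \<open>m\<close>
    agrees with it there and inherits its injectivity.\<close>
  have matched: "M u = Some (m u)" if "u \<in> R" for u
    using that by (auto simp: R robust_matched_def m_def)
  have finR: "finite R"
    using fin(1) by (rule finite_subset[rotated]) (auto simp: R robust_matched_def)
  have inj: "inj_on m R"
    using M(1) matched by (auto simp: bottleneck_matching_def inj_on_def dom_def)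
  have adj: "adjacency ?G u u' = adjacency G u u'" "adjacency ?H (m u) (m u') = adjacency H (m u) (m u')"
    if "u \<in> R" "u' \<in> R" for u u'
    using that by (simp_all add: adjacency_def induced_def)
  have node: "node_cost s ?G ?H u (m u) \<le> min (\<epsilon> / s) 1" if "u \<in> R" for u
  proof -
    have "pair_cost G H u (m u) \<le> ereal \<epsilon>"
      using pair_cost_le_matching_cost[OF fin M(1) matched[OF that]] M(2) by (rule order_trans)
    moreover have "pair_cost ?G ?H u (m u) = pair_cost G H u (m u)"
      by (simp add: pair_cost_def induced_def)
    \<comment> \<open>Without \<open>del\<close>, the simplifier would split the bound by the
      minimum before \<open>node_cost_le\<close> could match.\<close>
    ultimately show ?thesis
      using \<open>0 < s\<close> by (simp add: node_cost_le del: min.bounded_iff)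
  qed
  have "(\<Sum>u\<in>R. pmf \<mu> u * node_cost s ?G ?H u (m u)) \<le> (\<Sum>u\<in>R. pmf \<mu> u * min (\<epsilon> / s) 1)"
    using node by (intro sum_mono mult_left_mono) auto
  also have "\<dots> = min (\<epsilon> / s) 1"
    using sum_pmf_eq_1[OF finR supp] by (simp flip: sum_distrib_right)
  finally have node_sum: "(\<Sum>u\<in>R. pmf \<mu> u * node_cost s ?G ?H u (m u)) \<le> min (\<epsilon> / s) 1" .
  have "d_FPG \<alpha> s ?G ?H \<mu> (map_pmf m \<mu>) \<le> fused_objective \<alpha> s ?G ?H (graph_coupling m R \<mu>)"
    using d_FPG_attained[of ?G ?H \<mu> "map_pmf m \<mu>" \<alpha> s] graph_coupling_in_couplings[OF finR inj supp] finR image_mono[OF supp, of m] supp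
    by (auto simp: verts)
  also have "\<dots> = (1 - \<alpha>) * (\<Sum>u\<in>R. pmf \<mu> u * node_cost s ?G ?H u (m u)) + \<alpha> * edge_discrepancy G H M \<tau> \<mu>"
    using fused_objective_graph_coupling[of ?G ?H m \<alpha> s \<mu>] finR
    by (simp add: verts adj edge_discrepancy_def matched flip: R cong: sum.cong)
  also have "\<dots> \<le> (1 - \<alpha>) * min (\<epsilon> / s) 1 + \<alpha> * edge_discrepancy G H M \<tau> \<mu>"
    using node_sum \<open>\<alpha> \<le> 1\<close> by (intro add_right_mono mult_left_mono) auto
  finally show ?thesis .
qed

theorem theorem3p15:
  fixes K :: "'a cw_complex"
    and f g :: "'a set \<Rightarrow> real"
    and cs\<^sub>f cs\<^sub>g :: "'a set list"
    and V\<^sub>f V\<^sub>g :: "'k::field mat"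
    and q :: nat
    and M :: "'a set \<rightharpoonup> 'a set"
    and \<mu> :: "'a set pmf"
    and \<epsilon> \<tau> \<alpha> s :: real
  defines "G\<^sub>f \<equiv> pairing_graph K f cs\<^sub>f V\<^sub>f q"
    and "G\<^sub>g \<equiv> pairing_graph K g cs\<^sub>g V\<^sub>g q"
  defines "R \<equiv> robust_matched G\<^sub>f G\<^sub>g M \<tau>"
  assumes "finite_cw_complex K"
    and "filtration_function K f"
    and "filtration_function K g"
    and "reduction_data K f cs\<^sub>f V\<^sub>f"
    and "reduction_data K g cs\<^sub>g V\<^sub>g"
    and "\<forall>\<sigma>\<in>cells K. \<bar>f \<sigma> - g \<sigma>\<bar> \<le> \<epsilon>"
    and "bottleneck_matching G\<^sub>f G\<^sub>g M"
    and "matching_cost G\<^sub>f G\<^sub>g M \<le> ereal \<epsilon>"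
    and "0 \<le> \<tau>"
    and "R \<noteq> {}"
    and "set_pmf \<mu> \<subseteq> R"
    and "0 \<le> \<alpha>" and "\<alpha> \<le> 1"
    and "0 < s"
  shows "d_FPG \<alpha> s (induced G\<^sub>f R) (induced G\<^sub>g ((the \<circ> M) ` R)) \<mu> (map_pmf (the \<circ> M) \<mu>)
           \<le> (1 - \<alpha>) * min (\<epsilon> / s) 1 + \<alpha> * edge_discrepancy G\<^sub>f G\<^sub>g M \<tau> \<mu>"
proof -
  \<comment> \<open>The finiteness of the complex enters here: the vertices of both graphs are cells
    of \<open>K\<close>.\<close>
  have "finite (pverts G\<^sub>f)" "finite (pverts G\<^sub>g)"
    using \<open>finite_cw_complex K\<close>
    by (simp_all add: G\<^sub>f_def G\<^sub>g_def pairing_graph_def pairing_vertices_def finite_cw_complex_def)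
  then show ?thesis
    using assms by (intro d_FPG_robust_matched_le) simp_all
qed

end
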